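(* Let $n \geq 1$ be an integer and let $M$ be a positive semi-definite, symmetric, real $n\times n$ matrix with trace $N$, where $N$ is an integer with $N \geq n$. Then there exist $N$ unit vectors $v_1,\ldots,v_N$ in $\mathbb{R}^n$ such that $M = \sum_{i=1}^N v_i \otimes v_i$.
   Context: For $u, v \in \mathbb{R}^n$, the tensor product $u\otimes v$ is the linear map $\mathbb{R}^n\to\mathbb{R}^n$ given by $(u\otimes v)z = \langle z, v\rangle u$, i.e. the $n\times n$ matrix with entries $(u\otimes v)_{ij} = u_i v_j$. Unit vectors are vectors of Euclidean norm $1$. *)

theory Defs
  imports "HOL-Analysis.Analysis"
begin

definition pos_semidef :: "real ^ 'n ^ 'n \<Rightarrow> bool" where
  "pos_semidef A \<longleftrightarrow> (\<forall>x. 0 \<le> x \<bullet> (A *v x))"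

definition tensor :: "real ^ 'n \<Rightarrow> real ^ 'n \<Rightarrow> real ^ 'n ^ 'n" (infixl "\<otimes>" 75) where
  "u \<otimes> v = (\<chi> i j. u $ i * v $ j)"

lemma tensor_mult_vec: "(u \<otimes> v) *v z = (z \<bullet> v) *\<^sub>R u"
  by (simp add: vec_eq_iff tensor_def matrix_vector_mult_def inner_vec_def
      sum_distrib_left sum_distrib_right mult_ac)

end

theory Submission
  imports Defs
begin

text \<open>Peeling off one coordinate at a time (Cholesky) writes \<open>M\<close> as a sum of \<open>n \<le> N\<close> tensor
  squares, padded with zeros to \<open>N\<close> of them. Rotating a pair \<open>(a, b)\<close> of the vectors in the index
  plane does not change \<open>a \<otimes> a + b \<otimes> b\<close>. Since the squared norms have average \<open>1\<close>, one can pair a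
  vector of norm at most \<open>1\<close> with one of norm at least \<open>1\<close> and rotate until one of them is a unit
  vector; that vector is then set aside and the others again have average squared norm \<open>1\<close>.\<close>

lemma tensor_nth [simp]: "(u \<otimes> v) $ i $ j = u $ i * v $ j"
  by (simp add: tensor_def)

lemma trace_tensor: "trace (u \<otimes> v) = u \<bullet> v"
  by (simp add: trace_def inner_vec_def)

lemma trace_sum: "trace (\<Sum>i\<in>I. A i) = (\<Sum>i\<in>I. trace (A i :: real ^ 'n ^ 'n))"
  by (induction I rule: infinite_finite_induct) (simp_all add: trace_def sum.distrib)

text \<open>For \<open>a > 0\<close> the inequality is nonnegativity at the vertex
  \<open>t = - b / a\<close>. For \<open>a = 0\<close> the function is affine, and being bounded
  below forces \<open>b = 0\<close>.\<close>

lemma discriminant_nonpos: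
  fixes a b c :: real
  assumes "0 \<le> a" and nonneg: "\<And>t. 0 \<le> a * t\<^sup>2 + 2 * b * t + c"
  shows "b\<^sup>2 \<le> a * c"
proof (cases "a = 0")
  case True
  have "b = 0"
  proof (rule ccontr)
    assume "b \<noteq> 0"
    \<comment> \<open>At this \<open>t\<close> the affine function takes the value
      \<open>-1\<close>.\<close>
    then show False
      using nonneg[of "- (c + 1) / (2 * b)"] True by (simp add: field_simps)
  qed
  then show ?thesis
    using True by simp
next
  case False
  then show ?thesis
    using nonneg[of "- b / a"] \<open>0 \<le> a\<close> by (simp add: field_simps power2_eq_square)
qed

lemma inner_symmetric_matrix:
  assumes "transpose M = M"
  shows "x \<bullet> (M *v y) = (M *v x) \<bullet> (y :: real ^ 'n)"
  by (metis assms dot_lmul_matrix transpose_matrix_vector)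

lemma pos_semidef_Cauchy_Schwarz:
  fixes M :: "real ^ 'n ^ 'n"
  assumes "pos_semidef M" "transpose M = M"
  shows "(y \<bullet> (M *v x))\<^sup>2 \<le> (x \<bullet> (M *v x)) * (y \<bullet> (M *v y))"
proof (rule discriminant_nonpos)
  show "0 \<le> x \<bullet> (M *v x)"
    using assms(1) by (simp add: pos_semidef_def)
next
  fix t :: real
  have "x \<bullet> (M *v y) = y \<bullet> (M *v x)"
    using inner_symmetric_matrix[OF assms(2)] by (metis inner_commute)
  then have "(t *\<^sub>R x + y) \<bullet> (M *v (t *\<^sub>R x + y))
      = (x \<bullet> (M *v x)) * t\<^sup>2 + 2 * (y \<bullet> (M *v x)) * t + y \<bullet> (M *v y)"
    by (simp add: matrix_vector_right_distrib matrix_vector_mult_scaleR inner_add_left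
        inner_add_right power2_eq_square algebra_simps)
  then show "0 \<le> (x \<bullet> (M *v x)) * t\<^sup>2 + 2 * (y \<bullet> (M *v x)) * t + y \<bullet> (M *v y)"
    using assms(1) unfolding pos_semidef_def by metis
qed

text \<open>Induction on a set \<open>S\<close> containing the indices of all nonzero columns:
  subtracting a suitable \<open>u \<otimes> u\<close> clears column \<open>k\<close>, keeps the zero
  columns zero and preserves symmetry and semidefiniteness.\<close>

lemma pos_semidef_sum_tensor:
  fixes M :: "real ^ 'n ^ 'n"
  assumes "finite S" "pos_semidef M" "transpose M = M" "\<And>i. i \<notin> S \<Longrightarrow> column i M = 0"
  shows "\<exists>w. M = (\<Sum>i\<in>S. w i \<otimes> w i)"
  using assms
proof (induction S arbitrary: M rule: finite_induct)
  case empty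
  then have "M = 0"
    by (simp add: vec_eq_iff column_def)
  then show ?case
    by simp
next
  case (insert k S)
  define e :: "real ^ 'n" where "e = axis k 1"
  define a where "a = e \<bullet> (M *v e)"
  \<comment> \<open>If \<open>a = 0\<close> then \<open>M *v e = 0\<close> by Cauchy-Schwarz, so the junk value \<open>u = 0\<close> is the right one.\<close>
  define u where "u = (1 / sqrt a) *\<^sub>R (M *v e)"
  define M' where "M' = M - u \<otimes> u"
  note CS = pos_semidef_Cauchy_Schwarz[OF insert.prems(1,2)]
  have "a \<ge> 0"
    using insert.prems(1) by (simp add: a_def pos_semidef_def)
  \<comment> \<open>With \<open>y = M *v e\<close> and \<open>x = e\<close>, the left side of
    Cauchy-Schwarz is the fourth power of the norm of \<open>M *v e\<close>, and the right side has
    the factor \<open>a\<close>.\<close>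
  have Me: "M *v e = 0" if "a = 0"
    using CS[of "M *v e" e] that by (simp add: a_def)
  have Mv: "M' *v z = M *v z - (z \<bullet> u) *\<^sub>R u" for z
    by (simp add: M'_def matrix_vector_mult_diff_rdistrib tensor_mult_vec)
  have "pos_semidef M'"
    unfolding pos_semidef_def
  proof
    fix x
    \<comment> \<open>This suffices because subtracting \<open>u \<otimes> u\<close> lowers the
      quadratic form at \<open>x\<close> by exactly \<open>(x \<bullet> u)\<^sup>2\<close>.\<close>
    have "(x \<bullet> u)\<^sup>2 \<le> x \<bullet> (M *v x)"
    proof (cases "a = 0")
      case True
      then show ?thesis
        using insert.prems(1) by (simp add: u_def pos_semidef_def)
    next
      case False
      have "(x \<bullet> u)\<^sup>2 = (x \<bullet> (M *v e))\<^sup>2 / a"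
        using \<open>a \<ge> 0\<close> by (simp add: u_def power_divide)
      also have "\<dots> \<le> x \<bullet> (M *v x)"
        using CS[of x e] False \<open>a \<ge> 0\<close> by (simp add: a_def[symmetric] field_simps)
      finally show ?thesis .
    qed
    then show "0 \<le> x \<bullet> (M' *v x)"
      by (simp add: Mv inner_diff_right power2_eq_square)
  qed
  moreover have "transpose M' = M'"
    using insert.prems(2) by (simp add: M'_def transpose_def vec_eq_iff mult.commute)
  moreover have "column i M' = 0" if "i \<notin> S" for i
  proof (cases "i = k")
    case True
    \<comment> \<open>Since \<open>e \<bullet> u = sqrt a\<close>, the scaling of \<open>u\<close>
      is the one that makes column \<open>k\<close> of \<open>M'\<close> vanish.\<close>
    have "M *v e = (e \<bullet> u) *\<^sub>R u"
      using Me \<open>a \<ge> 0\<close> by (cases "a = 0") (simp_all add: u_def a_def[symmetric])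
    then show ?thesis
      using Mv[of e] True by (simp add: e_def matrix_vector_mult_basis)
  next
    case False
    then have z: "M *v axis i 1 = 0"
      using insert.prems(3) that by (simp add: matrix_vector_mult_basis)
    \<comment> \<open>By symmetry, a zero column \<open>i\<close> of \<open>M\<close> is also a zero
      row, so entry \<open>i\<close> of \<open>u\<close> is zero.\<close>
    have "axis i 1 \<bullet> u = 0"
      using z inner_symmetric_matrix[OF insert.prems(2), of "axis i 1" e] by (simp add: u_def)
    then show ?thesis
      using Mv[of "axis i 1"] z by (simp add: matrix_vector_mult_basis)
  qed
  ultimately obtain w where "M' = (\<Sum>i\<in>S. w i \<otimes> w i)"
    using insert.IH by blast
  moreover have "(\<Sum>i\<in>S. (w(k := u)) i \<otimes> (w(k := u)) i) = (\<Sum>i\<in>S. w i \<otimes> w i)"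
    using insert.hyps by (intro sum.cong) auto
  ultimately have "M = (\<Sum>i\<in>insert k S. (w(k := u)) i \<otimes> (w(k := u)) i)"
    using insert.hyps by (simp add: M'_def algebra_simps)
  then show ?case
    by blast
qed

text \<open>The norm of \<open>cos t *\<^sub>R a + sin t *\<^sub>R b\<close> moves continuously from
  \<open>norm a\<close> to \<open>norm b\<close> on the quarter turn, so it takes the value 1 in
  between.\<close>

lemma rotate_to_unit:
  fixes a b :: "real ^ 'n"
  assumes "norm a \<le> 1 \<and> 1 \<le> norm b \<or> norm b \<le> 1 \<and> 1 \<le> norm a"
  shows "\<exists>a' b'. norm a' = 1 \<and> a' \<otimes> a' + b' \<otimes> b' = a \<otimes> a + b \<otimes> b"
proof -
  define f where "f t = norm (cos t *\<^sub>R a + sin t *\<^sub>R b)" for t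
  have cont: "continuous_on {0..pi / 2} f"
    unfolding f_def by (intro continuous_intros)
  have ends: "f 0 = norm a" "f (pi / 2) = norm b"
    by (simp_all add: f_def)
  have "\<exists>t. f t = 1"
    using assms IVT'[of f 0 1 "pi / 2", OF _ _ _ cont] IVT2'[of f "pi / 2" 1 0, OF _ _ _ cont]
    by (auto simp: ends)
  then obtain t where t: "norm (cos t *\<^sub>R a + sin t *\<^sub>R b) = 1"
    by (auto simp: f_def)
  \<comment> \<open>One matrix entry of the invariance: \<open>x\<close>, \<open>x'\<close> stand
    for two coordinates of \<open>a\<close>, and \<open>y\<close>, \<open>y'\<close> for those of
    \<open>b\<close>.\<close>
  have rot: "(c * x + s * y) * (c * x' + s * y') + (c * y - s * x) * (c * y' - s * x')
      = x * x' + y * y'" if "s\<^sup>2 + c\<^sup>2 = 1" for c s x y x' y' :: real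
  proof -
    have "(c * x + s * y) * (c * x' + s * y') + (c * y - s * x) * (c * y' - s * x')
        = (s\<^sup>2 + c\<^sup>2) * (x * x' + y * y')"
      by (simp add: power2_eq_square algebra_simps)
    then show ?thesis
      using that by simp
  qed
  define a' b' where "a' = cos t *\<^sub>R a + sin t *\<^sub>R b" and "b' = cos t *\<^sub>R b - sin t *\<^sub>R a"
  have "a' \<otimes> a' + b' \<otimes> b' = a \<otimes> a + b \<otimes> b"
    by (simp add: vec_eq_iff a'_def b'_def rot)
  then show ?thesis
    using t a'_def by blast
qed

text \<open>The induction must allow arbitrary \<open>w\<close>, since making the vector at
  \<open>k\<close> a unit vector may also change one at an index in \<open>F\<close>.\<close>

lemma sum_tensor_unit_vectors:
  fixes w :: "'a \<Rightarrow> real ^ 'n"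
  assumes "finite I" "(\<Sum>i\<in>I. (norm (w i))\<^sup>2) = card I"
  shows "\<exists>v. (\<forall>i\<in>I. norm (v i) = 1) \<and> (\<Sum>i\<in>I. v i \<otimes> v i) = (\<Sum>i\<in>I. w i \<otimes> w i)"
  using assms
proof (induction I arbitrary: w rule: finite_induct)
  case empty
  then show ?case
    by simp
next
  case (insert k F)
  have total: "(norm (w k))\<^sup>2 + (\<Sum>i\<in>F. (norm (w i))\<^sup>2) = 1 + real (card F)"
    using insert.prems insert.hyps by simp
  obtain w' where unit: "norm (w' k) = 1"
    and same: "(\<Sum>i\<in>insert k F. w' i \<otimes> w' i) = (\<Sum>i\<in>insert k F. w i \<otimes> w i)"
  proof (cases "norm (w k) = 1")
    case True
    then show ?thesis
      using that by blast
  next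
    case False
    have "\<exists>j\<in>F. norm (w k) \<le> 1 \<and> 1 \<le> norm (w j) \<or> norm (w j) \<le> 1 \<and> 1 \<le> norm (w k)"
    proof (cases "norm (w k) < 1")
      case True
      then have "(norm (w k))\<^sup>2 < 1"
        by (simp add: abs_square_less_1)
      \<comment> \<open>A deficit at \<open>k\<close> is a surplus over \<open>F\<close>, so some
        vector there is long; the other case is the mirror image.\<close>
      then have "(\<Sum>i\<in>F. (norm (w i))\<^sup>2) > (\<Sum>i\<in>F. 1)"
        using total by simp
      then obtain j where "j \<in> F" "(norm (w j))\<^sup>2 > 1"
        by (meson not_le sum_mono)
      then show ?thesis
        using True by (smt (verit) norm_ge_zero power_le_one)
    next
      case large: False
      then have "(norm (w k))\<^sup>2 > 1"
        using False by (simp add: one_less_power)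
      then have "(\<Sum>i\<in>F. (norm (w i))\<^sup>2) < (\<Sum>i\<in>F. 1)"
        using total by simp
      then obtain j where "j \<in> F" "(norm (w j))\<^sup>2 < 1"
        by (meson not_le sum_mono)
      then show ?thesis
        using large by (smt (verit) one_le_power)
    qed
    then obtain j where "j \<in> F"
      and "norm (w k) \<le> 1 \<and> 1 \<le> norm (w j) \<or> norm (w j) \<le> 1 \<and> 1 \<le> norm (w k)"
      by blast
    then obtain a b where ab: "norm a = 1" "a \<otimes> a + b \<otimes> b = w k \<otimes> w k + w j \<otimes> w j"
      using rotate_to_unit by blast
    \<comment> \<open>The unit vector goes to \<open>k\<close>, the index that the induction
      removes; \<open>b\<close>, of whatever norm, stays in \<open>F\<close>.\<close>
    define w' where "w' = w(k := a, j := b)"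
    have "k \<noteq> j"
      using \<open>j \<in> F\<close> insert.hyps by auto
    have "(\<Sum>i\<in>F - {j}. w' i \<otimes> w' i) = (\<Sum>i\<in>F - {j}. w i \<otimes> w i)"
      using insert.hyps by (intro sum.cong) (auto simp: w'_def)
    then have "(\<Sum>i\<in>insert k F. w' i \<otimes> w' i) = (\<Sum>i\<in>insert k F. w i \<otimes> w i)"
      using ab(2) \<open>k \<noteq> j\<close> \<open>j \<in> F\<close> insert.hyps
      by (simp add: sum.remove[of F j] w'_def add.assoc[symmetric])
    moreover have "norm (w' k) = 1"
      using ab(1) \<open>k \<noteq> j\<close> by (simp add: w'_def)
    ultimately show ?thesis
      using that by blast
  qed
  \<comment> \<open>The trace of a tensor square is the squared norm, so equal tensor sums have
    equal total squared norm.\<close>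
  have "(\<Sum>i\<in>insert k F. (norm (w' i))\<^sup>2) = (\<Sum>i\<in>insert k F. (norm (w i))\<^sup>2)"
    using arg_cong[OF same, of trace]
    by (simp only: trace_sum trace_tensor power2_norm_eq_inner)
  then have "(\<Sum>i\<in>F. (norm (w' i))\<^sup>2) = card F"
    using total unit insert.hyps by simp
  then obtain v where v: "\<forall>i\<in>F. norm (v i) = 1"
    "(\<Sum>i\<in>F. v i \<otimes> v i) = (\<Sum>i\<in>F. w' i \<otimes> w' i)"
    using insert.IH by blast
  have "(\<Sum>i\<in>F. (v(k := w' k)) i \<otimes> (v(k := w' k)) i) = (\<Sum>i\<in>F. v i \<otimes> v i)"
    using insert.hyps by (intro sum.cong) auto
  then have "(\<Sum>i\<in>insert k F. (v(k := w' k)) i \<otimes> (v(k := w' k)) i)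
      = (\<Sum>i\<in>insert k F. w i \<otimes> w i)"
    unfolding same[symmetric] using v(2) insert.hyps by simp
  moreover have "\<forall>i\<in>insert k F. norm ((v(k := w' k)) i) = 1"
    using v(1) unit by simp
  ultimately show ?case
    by blast
qed

theorem theorem2:
  fixes M :: "real ^ 'n ^ 'n" and N :: nat
  assumes "pos_semidef M"
    and "transpose M = M"
    and "trace M = real N"
    and "N \<ge> CARD('n)"
  shows "\<exists>v :: nat \<Rightarrow> real ^ 'n.
           (\<forall>i\<in>{1..N}. norm (v i) = 1) \<and> M = (\<Sum>i\<in>{1..N}. v i \<otimes> v i)"
proof -
  have "\<exists>w. M = (\<Sum>i\<in>(UNIV :: 'n set). w i \<otimes> w i)"
    using assms(1,2) by (intro pos_semidef_sum_tensor) simp_all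
  then obtain w where w: "M = (\<Sum>i\<in>(UNIV :: 'n set). w i \<otimes> w i)"
    by blast
  obtain h where h: "bij_betw h {1..CARD('n)} (UNIV :: 'n set)"
    using ex_bij_betw_nat_finite_1[of "UNIV :: 'n set"] by auto
  define w' where "w' i = (if i \<le> CARD('n) then w (h i) else 0)" for i
  have "M = (\<Sum>i\<in>{1..CARD('n)}. w (h i) \<otimes> w (h i))"
    unfolding w by (rule sum.reindex_bij_betw[OF h, symmetric])
  also have "\<dots> = (\<Sum>i\<in>{1..N}. w' i \<otimes> w' i)"
    using assms(4) by (intro sum.mono_neutral_cong_left) (auto simp: w'_def vec_eq_iff)
  finally have M: "M = (\<Sum>i\<in>{1..N}. w' i \<otimes> w' i)" .
  \<comment> \<open>Here the trace hypothesis enters: it says that the \<open>N\<close> squared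
    norms average 1.\<close>
  have "(\<Sum>i\<in>{1..N}. (norm (w' i))\<^sup>2) = card {1..N}"
    using assms(3) unfolding M by (simp add: trace_sum trace_tensor power2_norm_eq_inner)
  then show ?thesis
    using sum_tensor_unit_vectors[of "{1..N}" w'] M by auto
qed

end
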